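(* Let $G$ be a finite abstract simplicial complex with Dirac matrix $D_G$. If $K\subset G$ is a subcomplex of $G$, then the eigenvalues of $D_K$ interlace the eigenvalues of $D_G$. The same holds if $K$ is replaced by an open set $U\subset G$, that is, the eigenvalues of $D_U$ interlace the eigenvalues of $D_G$.
   Context: A finite abstract simplicial complex $G$ is a finite set of non-empty finite sets (simplices) closed under taking non-empty subsets. A subcomplex is a subset $K\subset G$ that is itself closed under taking non-empty subsets. A set $U\subset G$ is open if $x\in U$, $y\in G$, $x\subset y$ imply $y\in U$. Fix an ordering of the vertices of each simplex. For $y\subset x$ with $|x|=|y|+1$, $\mathrm{sign}(x,y)\in\{1,-1\}$ is the sign of the permutation that takes the list $(v,y)$ ($v$ the vertex in $x\setminus y$, followed by the ordered vertices of $y$) to the ordered list of vertices of $x$. The exterior derivative $d$ is the matrix indexed by $G\times G$ with $d(x,y)=\mathrm{sign}(x,y)$ if $y\subset x$ and $|x|=|y|+1$, and $d(x,y)=0$ otherwise. The Dirac matrix is $D_G=d+d^*$, with $d^*$ the transpose. For a subset $A\subset G$ that is a subcomplex or open, $D_A$ is the matrix defined by the same formula with rows and columns indexed by $A$ (using the same vertex orderings). Interlacing, in the sense of the Cauchy interlace theorem: if $|G|=n$, $|A|=m$, $\lambda_1\le\cdots\le\lambda_n$ are the eigenvalues of $D_G$ and $\mu_1\le\cdots\le\mu_m$ those of $D_A$ (with multiplicity), then $\lambda_k\le\mu_k\le\lambda_{k+n-m}$ for all $1\le k\le m$. *)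

theory Defs
  imports "Jordan_Normal_Form.Char_Poly" "HOL-Combinatorics.Permutations"
begin

definition simplicial_complex :: "'a set set \<Rightarrow> bool" where
  "simplicial_complex G \<longleftrightarrow>
     finite G \<and> (\<forall>x\<in>G. finite x \<and> x \<noteq> {}) \<and> (\<forall>x\<in>G. \<forall>y. y \<subseteq> x \<and> y \<noteq> {} \<longrightarrow> y \<in> G)"

definition subcomplex :: "'a set set \<Rightarrow> 'a set set \<Rightarrow> bool" where
  "subcomplex K G \<longleftrightarrow> K \<subseteq> G \<and> (\<forall>x\<in>K. \<forall>y. y \<subseteq> x \<and> y \<noteq> {} \<longrightarrow> y \<in> K)"

definition open_subset :: "'a set set \<Rightarrow> 'a set set \<Rightarrow> bool" where
  "open_subset U G \<longleftrightarrow> U \<subseteq> G \<and> (\<forall>x\<in>U. \<forall>y\<in>G. x \<subseteq> y \<longrightarrow> y \<in> U)"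

text \<open>\<open>vs x\<close> lists the vertices of the simplex \<open>x\<close>; the orders chosen for different simplices
  are not required to be compatible.\<close>

definition vertex_ordering :: "'a set set \<Rightarrow> ('a set \<Rightarrow> 'a list) \<Rightarrow> bool" where
  "vertex_ordering G vs \<longleftrightarrow> (\<forall>x\<in>G. distinct (vs x) \<and> set (vs x) = x)"

text \<open>Meaningful only for \<open>y \<subset> x\<close> with \<open>card x = card y + 1\<close>: then \<open>x - y\<close> is a singleton and
  the described permutation of \<open>x\<close> exists and is unique.\<close>

definition incidence_sign :: "('a set \<Rightarrow> 'a list) \<Rightarrow> 'a set \<Rightarrow> 'a set \<Rightarrow> int" where
  "incidence_sign vs x y =
     sign (THE p. p permutes x \<and> map p (the_elem (x - y) # vs y) = vs x)"

definition exterior_derivative :: "('a set \<Rightarrow> 'a list) \<Rightarrow> 'a set \<Rightarrow> 'a set \<Rightarrow> real" where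
  "exterior_derivative vs x y =
     (if y \<subset> x \<and> card x = card y + 1 then of_int (incidence_sign vs x y) else 0)"

text \<open>A matrix with rows and columns indexed by a finite set \<open>A\<close> of simplices is represented with
  respect to an enumeration \<open>xs\<close> of \<open>A\<close> without repetitions.\<close>

definition exterior_derivative_mat :: "('a set \<Rightarrow> 'a list) \<Rightarrow> 'a set list \<Rightarrow> real mat" where
  "exterior_derivative_mat vs xs =
     mat (length xs) (length xs) (\<lambda>(i, j). exterior_derivative vs (xs ! i) (xs ! j))"

definition dirac_mat :: "('a set \<Rightarrow> 'a list) \<Rightarrow> 'a set list \<Rightarrow> real mat" where
  "dirac_mat vs xs =
     exterior_derivative_mat vs xs + transpose_mat (exterior_derivative_mat vs xs)"

text \<open>The real eigenvalues in non-decreasing order, repeated according to algebraic multiplicity.\<close>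

definition eigenvalue_list :: "real mat \<Rightarrow> real list" where
  "eigenvalue_list M = sorted_list_of_multiset (proots (char_poly M))"

text \<open>The two length conditions say that each matrix has as many real eigenvalues as rows, so that
  all list accesses are within bounds. Indices start at 0.\<close>

definition eigenvalues_interlace :: "real mat \<Rightarrow> real mat \<Rightarrow> bool" where
  "eigenvalues_interlace B M \<longleftrightarrow>
     (let n = dim_row M; m = dim_row B; l = eigenvalue_list M; u = eigenvalue_list B in
        m \<le> n \<and> length l = n \<and> length u = m \<and>
        (\<forall>k<m. l ! k \<le> u ! k \<and> u ! k \<le> l ! (k + (n - m))))"

end

theory Submission
  imports Defs "Jordan_Normal_Form.Schur_Decomposition"
begin

text \<open>
  An entry of the Dirac matrix depends only on the two simplices that index it. Hence the Dirac
  matrix of any subset of \<open>G\<close>, in whatever order it is enumerated, is a principal submatrix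
  \<open>E\<^sup>T A E\<close> of the Dirac matrix \<open>A\<close> of \<open>G\<close>, where \<open>E\<close> is a coordinate embedding, and Cauchy
  interlacing applies. Diagonalising both matrices orthogonally turns \<open>E\<close> into \<open>R\<close> with
  \<open>R\<^sup>T R = 1\<close> and \<open>R\<^sup>T diag(l) R = diag(u)\<close>. For each of the two inequalities at \<open>k\<close>, a dimension
  count gives \<open>c \<noteq> 0\<close> such that \<open>c\<close> is supported on one side of \<open>k\<close> and \<open>R c\<close> on the opposite
  side of \<open>k\<close> or \<open>k + n - m\<close>; comparing the Rayleigh quotients of \<open>c\<close> and \<open>R c\<close> gives the bound.
\<close>

section \<open>Diagonalisation of real symmetric matrices\<close>

text \<open>Moving the real symmetric matrix across the Hermitian product of an eigenvector
  \<open>v\<close> with itself evaluates that product scaled both by \<open>a\<close> and by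
  \<open>cnj a\<close>; since it is nonzero, the two scalars agree.\<close>

lemma symmetric_complex_eigenvalue_real:
  fixes A :: "real mat"
  assumes A: "A \<in> carrier_mat n n" and sym: "transpose_mat A = A"
    and ev: "eigenvalue (map_mat complex_of_real A) a"
  shows "a \<in> \<real>"
proof -
  let ?C = "map_mat complex_of_real A"
  from ev obtain v where v: "v \<in> carrier_vec n" "v \<noteq> 0\<^sub>v n" "?C *\<^sub>v v = a \<cdot>\<^sub>v v"
    using A unfolding eigenvalue_def eigenvector_def by auto
  have C: "?C \<in> carrier_mat n n" using A by simp
  have symC: "transpose_mat ?C = ?C" using sym by (metis map_mat_transpose)
  have conjC: "?C *\<^sub>v conjugate v = conjugate (?C *\<^sub>v v)"
    by (rule eq_vecI, insert A v(1), auto simp: scalar_prod_def sum_conjugate conjugate_dist_mul)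
  have "a * (v \<bullet>c v) = (?C *\<^sub>v v) \<bullet> conjugate v"
    using v by simp
  also have "\<dots> = v \<bullet> (?C *\<^sub>v conjugate v)"
    using transpose_vec_mult_scalar[OF C, of "conjugate v" v] v symC by simp
  also have "\<dots> = v \<bullet> conjugate (a \<cdot>\<^sub>v v)"
    unfolding conjC v ..
  also have "\<dots> = cnj a * (v \<bullet>c v)"
    using v by (simp add: conjugate_smult_vec)
  finally have "a = cnj a" using v by simp
  then show ?thesis by (metis Reals_cnj_iff)
qed

text \<open>The characteristic polynomial factors over the complex numbers and its roots are real
  eigenvalues; injectivity of the embedding of real polynomials pulls the factorisation
  back.\<close>

lemma symmetric_char_poly_splits:
  fixes A :: "real mat"
  assumes A: "A \<in> carrier_mat n n" and sym: "transpose_mat A = A"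
  obtains es where "char_poly A = (\<Prod>e\<leftarrow>es. [:- e, 1:])"
proof -
  let ?C = "map_mat complex_of_real A"
  have C: "?C \<in> carrier_mat n n" using A by simp
  interpret h: map_poly_inj_comm_ring_hom complex_of_real ..
  obtain as where as: "char_poly ?C = (\<Prod>a\<leftarrow>as. [:- a, 1:])"
    using char_poly_factorized[OF C] by blast
  have real: "complex_of_real (Re a) = a" if "a \<in> set as" for a
  proof -
    have "poly (char_poly ?C) a = 0" unfolding as using that
      by (auto simp: poly_prod_list prod_list_zero_iff image_iff intro!: bexI[of _ a])
    then have "eigenvalue ?C a" using eigenvalue_root_char_poly[OF C] by simp
    then show ?thesis using symmetric_complex_eigenvalue_real[OF A sym] by simp
  qed
  have "map_poly complex_of_real (char_poly A) = char_poly ?C"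
    by (simp add: of_real_hom.char_poly_hom[OF A])
  also have "\<dots> = (\<Prod>a\<leftarrow>as. map_poly complex_of_real [:- Re a, 1:])"
    unfolding as by (rule arg_cong[of _ _ prod_list], rule map_cong) (auto simp: real)
  also have "\<dots> = map_poly complex_of_real (\<Prod>e\<leftarrow>map Re as. [:- e, 1:])"
    by (simp add: h.hom_prod_list o_def)
  finally have "char_poly A = (\<Prod>e\<leftarrow>map Re as. [:- e, 1:])" by simp
  then show thesis by (rule that)
qed

section \<open>Orthogonal diagonalisation by deflation\<close>

text \<open>Gram-Schmidt on a completion of \<open>v\<close> to a basis keeps \<open>v\<close> in
  first place; normalising the resulting vectors gives the columns of \<open>W\<close>. For an
  eigenvector \<open>v\<close> this is the change of basis that splits off its eigenvalue.\<close>

lemma orthogonal_mat_with_first_col: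
  fixes v :: "real vec"
  assumes v: "v \<in> carrier_vec n" "v \<noteq> 0\<^sub>v n"
  obtains W c where "W \<in> carrier_mat n n" "transpose_mat W * W = 1\<^sub>m n" "col W 0 = c \<cdot>\<^sub>v v"
proof -
  interpret cof_vec_space n "TYPE(real)" .
  note bc = basis_completion[OF v]
  define ws where "ws = gram_schmidt n (basis_completion v)"
  have n: "n \<noteq> 0" using v by (metis carrier_vecD eq_vecI less_nat_zero_code zero_carrier_vec)
  from gram_schmidt_result[OF bc(2,4,5) ws_def]
  have ws: "set ws \<subseteq> carrier_vec n" "corthogonal ws" "length ws = n"
    using bc(6) by auto
  have hd: "ws ! 0 = v"
  proof -
    have "hd ws = v" using gram_schmidt_hd[OF v(1)] bc(6,7) n unfolding ws_def
      by (cases "basis_completion v") auto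
    moreover have "ws \<noteq> []" using ws(3) n by auto
    ultimately show ?thesis by (simp add: hd_conv_nth)
  qed
  \<comment> \<open>Gram-Schmidt only makes the vectors orthogonal; \<open>s j\<close> is the
    reciprocal length of the \<open>j\<close>-th one.\<close>
  define s where "s j = 1 / sqrt (ws ! j \<bullet> ws ! j)" for j
  define W where "W = mat n n (\<lambda>(i, j). s j * (ws ! j) $ i)"
  have wsc: "ws ! j \<in> carrier_vec n" if "j < n" for j using ws that by auto
  have col: "col W j = s j \<cdot>\<^sub>v ws ! j" if "j < n" for j
    using wsc[OF that] that by (intro eq_vecI) (auto simp: W_def)
  have orth: "ws ! i \<bullet> ws ! j = 0 \<longleftrightarrow> i \<noteq> j" if "i < n" "j < n" for i j
  proof -
    \<comment> \<open>Over the reals conjugation is trivial, so \<open>corthogonal\<close> means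
      ordinary orthogonality of nonzero vectors.\<close>
    have "conjugate (ws ! j) = ws ! j" by (rule eq_vecI) auto
    then show ?thesis using corthogonalD[OF ws(2), of i j] that ws(3) by simp
  qed
  have W: "W \<in> carrier_mat n n" by (simp add: W_def)
  have "transpose_mat W * W = 1\<^sub>m n"
  proof (rule eq_matI)
    fix i j assume "i < dim_row (1\<^sub>m n)" "j < dim_col (1\<^sub>m n)"
    then have ij: "i < n" "j < n" by auto
    have "(transpose_mat W * W) $$ (i, j) = s i * s j * (ws ! i \<bullet> ws ! j)"
      using ij W wsc[THEN carrier_vecD] by (simp add: col)
    also have "\<dots> = 1\<^sub>m n $$ (i, j)"
    proof (cases "i = j")
      case True
      have "ws ! i \<bullet> ws ! i \<ge> 0" by (simp add: scalar_prod_def sum_nonneg)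
      moreover have "ws ! i \<bullet> ws ! i \<noteq> 0" using orth ij by simp
      ultimately show ?thesis using True ij by (simp add: s_def)
    qed (use orth ij in simp)
    finally show "(transpose_mat W * W) $$ (i, j) = 1\<^sub>m n $$ (i, j)" .
  qed (use W in auto)
  then show thesis using that[OF W _ col[of 0, unfolded hd]] n by blast
qed

text \<open>Induction on the list of roots: each step splits off the head of \<open>es\<close> as a
  1 by 1 block and leaves a symmetric matrix whose characteristic polynomial has the remaining
  roots. Since \<open>es\<close> prescribes the order on the diagonal, a sorted list yields a sorted
  diagonal.\<close>

lemma spectral_theorem:
  fixes A :: "real mat"
  assumes "A \<in> carrier_mat n n" "transpose_mat A = A" "char_poly A = (\<Prod>e\<leftarrow>es. [:- e, 1:])"
  obtains P where "P \<in> carrier_mat n n" "transpose_mat P * P = 1\<^sub>m n"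
    "transpose_mat P * A * P = mat_diag n ((!) es)"
proof -
  have "\<exists>P \<in> carrier_mat n n. transpose_mat P * P = 1\<^sub>m n \<and>
      transpose_mat P * A * P = mat_diag n ((!) es)"
    using assms
  proof (induction es arbitrary: n A)
    case Nil
    then have "n = 0" using degree_monic_char_poly[of A n] by simp
    with Nil.prems(1) show ?case
      by (intro bexI[of _ "1\<^sub>m 0"] conjI eq_matI) (auto simp: mat_diag_def)
  next
    case (Cons e es)
    note A = Cons.prems(1) and sym = Cons.prems(2)
    have "eigenvalue A e" unfolding eigenvalue_root_char_poly[OF A] Cons.prems by simp
    then obtain v where v: "v \<in> carrier_vec n" "v \<noteq> 0\<^sub>v n" "A *\<^sub>v v = e \<cdot>\<^sub>v v"
      using A unfolding eigenvalue_def eigenvector_def by auto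
    have "n \<noteq> 0" using v by (metis carrier_vecD eq_vecI less_nat_zero_code zero_carrier_vec)
    then obtain k where k: "n = 1 + k" by (metis Suc_pred' bot_nat_0.not_eq_extremum plus_1_eq_Suc)
    obtain W c where W: "W \<in> carrier_mat n n" "transpose_mat W * W = 1\<^sub>m n"
      and W0: "col W 0 = c \<cdot>\<^sub>v v"
      using orthogonal_mat_with_first_col[OF v(1,2)] .
    define A' where "A' = transpose_mat W * A * W"
    define A3 where "A3 = mat k k (\<lambda>(i, j). A' $$ (Suc i, Suc j))"
    let ?e = "mat 1 1 (\<lambda>_. e)"
    have A': "A' \<in> carrier_mat n n" using W A by (simp add: A'_def)
    have A3: "A3 \<in> carrier_mat k k" by (simp add: A3_def)
    have symA': "transpose_mat A' = A'"
      using W A sym by (simp add: A'_def transpose_mult[of _ n n _ n])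
    \<comment> \<open>The first column of \<open>W\<close> is still an eigenvector for
      \<open>e\<close>, so the first column of \<open>A'\<close> is \<open>e\<close> times that of
      \<open>transpose_mat W * W\<close>, the identity. Symmetry of \<open>A'\<close> then gives the
      first row.\<close>
    have A'0: "A' $$ (i, 0) = (if i = 0 then e else 0)" if i: "i < n" for i
    proof -
      have "A' = transpose_mat W * (A * W)" using W A by (simp add: A'_def)
      then have "A' $$ (i, 0) = col W i \<bullet> (A *\<^sub>v col W 0)"
        using W(1) A i k col_mult2[OF A W(1), of 0] by (simp del: col_mult2)
      also have "A *\<^sub>v col W 0 = e \<cdot>\<^sub>v col W 0"
        unfolding W0 using A v by (auto simp: mult_mat_vec[of _ n n] smult_smult_assoc mult.commute)
      also have "col W i \<bullet> (e \<cdot>\<^sub>v col W 0) = e * (transpose_mat W * W) $$ (i, 0)"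
        using W(1) i k by simp
      finally show ?thesis unfolding W(2) using i k by simp
    qed
    have A'0': "A' $$ (0, i) = (if i = 0 then e else 0)" if i: "i < n" for i
      using A'0[OF i] arg_cong[OF symA', of "\<lambda>M. M $$ (i, 0)"] A' i k by simp
    have block: "A' = four_block_mat ?e (0\<^sub>m 1 k) (0\<^sub>m k 1) A3"
      using A' A'0 A'0' k by (intro eq_matI) (auto simp: A3_def)
    have symA3: "transpose_mat A3 = A3"
    proof (rule eq_matI)
      fix i j assume "i < dim_row A3" "j < dim_col A3"
      then have ij: "i < k" "j < k" using A3 by auto
      then show "transpose_mat A3 $$ (i, j) = A3 $$ (i, j)"
        using arg_cong[OF symA', of "\<lambda>M. M $$ (Suc i, Suc j)"] A' k by (simp add: A3_def)
    qed (use A3 in auto)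
    have WW: "W * transpose_mat W = 1\<^sub>m n"
      using mat_mult_left_right_inverse[of "transpose_mat W" n W] W by auto
    \<comment> \<open>Similarity preserves the characteristic polynomial, and the block form of
      \<open>A'\<close> factors it; cancelling the linear factor of \<open>e\<close> leaves the
      polynomial needed for the induction hypothesis.\<close>
    have "similar_mat A' A" unfolding similar_mat_def
      by (intro exI, rule similar_mat_witI[of "transpose_mat W" W n A' A])
        (use W A A' WW in \<open>auto simp: A'_def\<close>)
    then have "char_poly A' = [:- e, 1:] * (\<Prod>e\<leftarrow>es. [:- e, 1:])"
      using char_poly_similar[of A' A] Cons.prems(3) by simp
    moreover have "char_poly A' = char_poly ?e * char_poly A3"
      unfolding block by (rule char_poly_four_block_zeros_col) (use A3 in auto)
    moreover have "char_poly ?e = [:- e, 1:]"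
      by (subst char_poly_upper_triangular[of _ 1]) (auto simp: diag_mat_def)
    ultimately have "[:- e, 1:] * char_poly A3 = [:- e, 1:] * (\<Prod>e\<leftarrow>es. [:- e, 1:])"
      by metis
    then have "char_poly A3 = (\<Prod>e\<leftarrow>es. [:- e, 1:])"
      by (subst (asm) mult_left_cancel) auto
    from Cons.IH[OF A3 symA3 this] obtain Q where Q: "Q \<in> carrier_mat k k"
      "transpose_mat Q * Q = 1\<^sub>m k" "transpose_mat Q * A3 * Q = mat_diag k ((!) es)" by blast
    \<comment> \<open>\<open>F\<close> applies \<open>Q\<close> to the last \<open>k\<close>
      coordinates and fixes the first, so \<open>W * F\<close> diagonalises
      \<open>A\<close>.\<close>
    define F where "F = four_block_mat (1\<^sub>m 1) (0\<^sub>m 1 k) (0\<^sub>m k 1) Q"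
    have F: "F \<in> carrier_mat n n" unfolding F_def k by (rule four_block_carrier_mat) (use Q in auto)
    have FT: "transpose_mat F = four_block_mat (1\<^sub>m 1) (0\<^sub>m 1 k) (0\<^sub>m k 1) (transpose_mat Q)"
      unfolding F_def by (subst transpose_four_block_mat[of _ 1 1 _ k _ k]) (use Q in auto)
    have FF: "transpose_mat F * F = 1\<^sub>m n"
      unfolding FT unfolding F_def
      by (subst mult_four_block_mat[of _ 1 1 _ k _ k _ _ 1 _ k]) (use Q in \<open>auto simp: k\<close>)
    have "transpose_mat F * A' * F = four_block_mat ?e (0\<^sub>m 1 k) (0\<^sub>m k 1) (mat_diag k ((!) es))"
      unfolding FT block unfolding F_def using Q A3
      by (simp add: mult_four_block_mat[of _ 1 1 _ k _ k _ _ 1 _ k] del: One_nat_def)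
    also have "\<dots> = mat_diag n ((!) (e # es))"
      by (rule eq_matI) (auto simp: k mat_diag_def nth_Cons')
    finally have FAF: "transpose_mat F * A' * F = mat_diag n ((!) (e # es))" .
    have T: "transpose_mat (W * F) = transpose_mat F * transpose_mat W"
      using W F by (simp add: transpose_mult[of _ n n _ n])
    have "transpose_mat (W * F) * (W * F) = transpose_mat F * ((transpose_mat W * W) * F)"
      unfolding T using W(1) F by (simp add: assoc_mult_mat[of _ n n _ n _ n])
    also have "\<dots> = 1\<^sub>m n" using W F FF by simp
    finally have "transpose_mat (W * F) * (W * F) = 1\<^sub>m n" .
    moreover have "transpose_mat (W * F) * A * (W * F) = transpose_mat F * A' * F"
      unfolding T A'_def using W(1) F A by (simp add: assoc_mult_mat[of _ n n _ n _ n])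
    ultimately show ?case using FAF W F by (intro bexI[of _ "W * F"]) auto
  qed
  then show thesis using that by blast
qed

text \<open>The sorted list is a rearrangement of the roots in any splitting, and the product of
  linear factors depends only on their multiset. It can therefore serve as \<open>es\<close> in
  \<open>spectral_theorem\<close>.\<close>

lemma eigenvalue_list_symmetric:
  assumes A: "A \<in> carrier_mat n n" and sym: "transpose_mat A = A"
  shows "char_poly A = (\<Prod>e\<leftarrow>eigenvalue_list A. [:- e, 1:])" (is ?split)
    and "length (eigenvalue_list A) = n"
    and "sorted (eigenvalue_list A)"
proof -
  obtain es where es: "char_poly A = (\<Prod>e\<leftarrow>es. [:- e, 1:])"
    using symmetric_char_poly_splits[OF A sym] .
  have "proots (\<Prod>e\<leftarrow>es. [:- e, 1:]) = mset es"
    by (induction es) (simp_all add: proots_mult prod_list_zero_iff image_iff del: mult_pCons_left)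
  then have mset: "mset (eigenvalue_list A) = mset es"
    by (simp add: eigenvalue_list_def es)
  have "prod_list (map (\<lambda>e. [:- e, 1:]) xs) = prod_mset (image_mset (\<lambda>e. [:- e, 1:]) (mset xs))"
    for xs :: "real list" by (induction xs) auto
  then show ?split using es mset by metis
  then have "degree (\<Prod>e\<leftarrow>eigenvalue_list A. [:- e, 1:]) = n"
    using degree_monic_char_poly[OF A] by simp
  then show "length (eigenvalue_list A) = n" by (simp add: degree_linear_factors)
  show "sorted (eigenvalue_list A)" by (simp add: eigenvalue_list_def)
qed

section \<open>Cauchy interlacing\<close>

text \<open>The dimension count: the zero row leaves room for \<open>m - 1\<close> linear conditions on \<open>m\<close> unknowns.\<close>

lemma zero_row_kernel:
  fixes M :: "nat \<Rightarrow> nat \<Rightarrow> real"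
  assumes k: "k < m" and zero: "\<And>j. j < m \<Longrightarrow> M k j = 0"
  obtains c where "c \<in> carrier_vec m" "c \<noteq> 0\<^sub>v m" "\<And>i. i < m \<Longrightarrow> (\<Sum>j<m. M i j * c $ j) = 0"
proof -
  let ?M = "mat m m (\<lambda>(i, j). M i j)"
  have M: "?M \<in> carrier_mat m m" by simp
  have "det ?M = 0"
    using k by (simp add: laplace_expansion_row[OF M k] zero)
  then obtain c where c: "c \<in> carrier_vec m" "c \<noteq> 0\<^sub>v m" "?M *\<^sub>v c = 0\<^sub>v m"
    using det_0_iff_vec_prod_zero[OF M] by blast
  have "(\<Sum>j<m. M i j * c $ j) = 0" if "i < m" for i
    using arg_cong[OF c(3), of "\<lambda>v. v $ i"] that c(1)
    by (simp add: scalar_prod_def atLeast0LessThan)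
  then show thesis using that c by blast
qed

section \<open>Comparison of Rayleigh quotients\<close>

lemma quadratic_form_mat_diag:
  fixes c :: "real vec"
  assumes "c \<in> carrier_vec n"
  shows "c \<bullet> (mat_diag n f *\<^sub>v c) = (\<Sum>i<n. f i * (c $ i)\<^sup>2)"
proof -
  have "(mat_diag n f *\<^sub>v c) $ i = f i * c $ i" if "i < n" for i
  proof -
    have "(mat_diag n f *\<^sub>v c) $ i = (\<Sum>j<n. (if j = i then f j * c $ j else 0))"
      using that assms
      by (simp add: mat_diag_def scalar_prod_def atLeast0LessThan if_distrib[of "\<lambda>x. x * _"] cong: if_cong)
    then show ?thesis using that by simp
  qed
  then show ?thesis using assms
    by (simp add: scalar_prod_def atLeast0LessThan power2_eq_square mat_diag_def mult_ac)
qed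

text \<open>The adjoint of \<open>R\<close> is its transpose. A diagonal \<open>D\<close> turns this
  into an identity of weighted sums of squares; \<open>D\<close> equal to the identity makes
  \<open>R\<close> norm preserving when its columns are orthonormal.\<close>

lemma quadratic_form_compress:
  fixes R :: "real mat"
  assumes R: "R \<in> carrier_mat n m" and D: "D \<in> carrier_mat n n" and c: "c \<in> carrier_vec m"
  shows "(R *\<^sub>v c) \<bullet> (D *\<^sub>v (R *\<^sub>v c)) = c \<bullet> ((transpose_mat R * D * R) *\<^sub>v c)"
proof -
  have "c \<bullet> ((transpose_mat R * D * R) *\<^sub>v c) = c \<bullet> (transpose_mat R *\<^sub>v (D *\<^sub>v (R *\<^sub>v c)))"
    using assms by (simp add: assoc_mult_mat_vec[of _ m n _ m] assoc_mult_mat_vec[of _ m n _ n])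
  also have "\<dots> = (R *\<^sub>v c) \<bullet> (D *\<^sub>v (R *\<^sub>v c))"
    using transpose_vec_mult_scalar[OF R c, of "D *\<^sub>v (R *\<^sub>v c)"] R D c
    by (metis comm_scalar_prod mult_mat_vec_carrier transpose_carrier_mat)
  finally show ?thesis by simp
qed

lemma diagonal_interlacing:
  fixes R :: "real mat" and l u :: "nat \<Rightarrow> real"
  assumes R: "R \<in> carrier_mat n m" and RR: "transpose_mat R * R = 1\<^sub>m m"
    and diag: "transpose_mat R * mat_diag n l * R = mat_diag m u"
    and l: "\<And>i j. i \<le> j \<Longrightarrow> j < n \<Longrightarrow> l i \<le> l j" and u: "\<And>i j. i \<le> j \<Longrightarrow> j < m \<Longrightarrow> u i \<le> u j"
    and mn: "m \<le> n" and k: "k < m"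
  shows "l k \<le> u k" and "u k \<le> l (k + (n - m))"
proof -
  have norm: "(\<Sum>i<n. ((R *\<^sub>v c) $ i)\<^sup>2) = (\<Sum>i<m. (c $ i)\<^sup>2)"
    and form: "(\<Sum>i<n. l i * ((R *\<^sub>v c) $ i)\<^sup>2) = (\<Sum>i<m. u i * (c $ i)\<^sup>2)"
    if c: "c \<in> carrier_vec m" for c
  proof -
    have Rc: "R *\<^sub>v c \<in> carrier_vec n" using R c by simp
    show "(\<Sum>i<n. l i * ((R *\<^sub>v c) $ i)\<^sup>2) = (\<Sum>i<m. u i * (c $ i)\<^sup>2)"
      using quadratic_form_compress[OF R mat_diag_dim c, of l]
      unfolding diag quadratic_form_mat_diag[OF Rc] quadratic_form_mat_diag[OF c] .
    \<comment> \<open>The identity is the diagonal matrix with constant weight 1, so the norm is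
      another case of the quadratic form.\<close>
    have "transpose_mat R * 1\<^sub>m n * R = mat_diag m (\<lambda>_. 1)" using R RR by simp
    with quadratic_form_compress[OF R one_carrier_mat c]
    have "(R *\<^sub>v c) \<bullet> (mat_diag n (\<lambda>_. 1) *\<^sub>v (R *\<^sub>v c)) = c \<bullet> (mat_diag m (\<lambda>_. 1) *\<^sub>v c)"
      by simp
    then show "(\<Sum>i<n. ((R *\<^sub>v c) $ i)\<^sup>2) = (\<Sum>i<m. (c $ i)\<^sup>2)"
      unfolding quadratic_form_mat_diag[OF Rc] quadratic_form_mat_diag[OF c] by simp
  qed
  have pos: "(\<Sum>i<m. (c $ i)\<^sup>2) > 0" if c: "c \<in> carrier_vec m" "c \<noteq> 0\<^sub>v m" for c :: "real vec"
  proof -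
    obtain i where "i < m" "c $ i \<noteq> 0"
      using c by (metis carrier_vecD eq_vecI index_zero_vec)
    then show ?thesis by (intro sum_pos2[of _ i]) auto
  qed
  have Rc: "(R *\<^sub>v c) $ i = (\<Sum>j<m. R $$ (i, j) * c $ j)" if "c \<in> carrier_vec m" "i < n" for c i
    using R that by (simp add: scalar_prod_def atLeast0LessThan)
  have delta: "(\<Sum>j<m. (if j = i then 1 else 0) * c $ j) = c $ i" if "i < m" for i and c :: "real vec"
    using that by (simp add: if_distrib[of "\<lambda>x. x * _"] cong: if_cong)

  \<comment> \<open>Rows \<open>i < k\<close> make \<open>R c\<close> vanish below \<open>k\<close>,
    rows \<open>i > k\<close> make \<open>c\<close> vanish above \<open>k\<close>, and row
    \<open>k\<close> is the zero row. Thus only weights \<open>l i\<close> \<ge> \<open>l k\<close>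
    and \<open>u i\<close> \<le> \<open>u k\<close> contribute.\<close>
  obtain c where c: "c \<in> carrier_vec m" "c \<noteq> 0\<^sub>v m" and eq:
    "\<And>i. i < m \<Longrightarrow> (\<Sum>j<m. (if i < k then R $$ (i, j) else if i = k then 0
       else if j = i then 1 else 0) * c $ j) = 0"
    by (rule zero_row_kernel[OF k, of "\<lambda>i j. if i < k then R $$ (i, j) else if i = k then 0
       else if j = i then 1 else 0"]) auto
  have d0: "(R *\<^sub>v c) $ i = 0" if "i < k" for i using eq[of i] that k mn Rc[OF c(1), of i] by simp
  have c0: "c $ i = 0" if "i > k" "i < m" for i using eq[of i] that delta[of i c] by simp
  have "l k * (\<Sum>i<m. (c $ i)\<^sup>2) = (\<Sum>i<n. l k * ((R *\<^sub>v c) $ i)\<^sup>2)"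
    by (simp add: norm[OF c(1)] flip: sum_distrib_left)
  also have "\<dots> \<le> (\<Sum>i<n. l i * ((R *\<^sub>v c) $ i)\<^sup>2)"
  proof (rule sum_mono)
    fix i assume "i \<in> {..<n}"
    then show "l k * ((R *\<^sub>v c) $ i)\<^sup>2 \<le> l i * ((R *\<^sub>v c) $ i)\<^sup>2"
      using d0[of i] l[of k i] by (cases "i < k") (auto intro: mult_right_mono)
  qed
  also have "\<dots> = (\<Sum>i<m. u i * (c $ i)\<^sup>2)" by (rule form[OF c(1)])
  also have "\<dots> \<le> (\<Sum>i<m. u k * (c $ i)\<^sup>2)"
  proof (rule sum_mono)
    fix i assume "i \<in> {..<m}"
    then show "u i * (c $ i)\<^sup>2 \<le> u k * (c $ i)\<^sup>2"
      using c0[of i] u[of i k] k by (cases "i > k") (auto intro: mult_right_mono)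
  qed
  finally show "l k \<le> u k" using pos[OF c] by (simp flip: sum_distrib_left)

  let ?K = "k + (n - m)"
  \<comment> \<open>Mirror image: rows \<open>i < k\<close> make \<open>c\<close> vanish below
    \<open>k\<close>. As \<open>i\<close> runs from \<open>k + 1\<close> to \<open>m - 1\<close>,
    the index \<open>i + (n - m)\<close> runs over exactly the positions from \<open>?K + 1\<close>
    to \<open>n - 1\<close>, where \<open>R c\<close> is made to vanish.\<close>
  obtain c where c: "c \<in> carrier_vec m" "c \<noteq> 0\<^sub>v m" and eq:
    "\<And>i. i < m \<Longrightarrow> (\<Sum>j<m. (if i > k then R $$ (i + (n - m), j) else if i = k then 0
       else if j = i then 1 else 0) * c $ j) = 0"
    by (rule zero_row_kernel[OF k, of "\<lambda>i j. if i > k then R $$ (i + (n - m), j) else if i = k then 0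
       else if j = i then 1 else 0"]) auto
  have d0: "(R *\<^sub>v c) $ i = 0" if "i > ?K" "i < n" for i
  proof -
    \<comment> \<open>Replacing the truncated difference \<open>n - m\<close> by \<open>q\<close>
      shows that row \<open>p = i - q\<close> is the condition on entry \<open>i\<close>.\<close>
    obtain q where q: "n = m + q" using mn le_iff_add by blast
    define p where "p = i - q"
    have "i = p + q" using that q by (simp add: p_def)
    then show ?thesis using eq[of p] that q Rc[OF c(1), of i] by simp
  qed
  have c0: "c $ i = 0" if "i < k" for i using eq[of i] that k delta[of i c] by simp
  have "u k * (\<Sum>i<m. (c $ i)\<^sup>2) = (\<Sum>i<m. u k * (c $ i)\<^sup>2)"
    by (simp add: sum_distrib_left)
  also have "\<dots> \<le> (\<Sum>i<m. u i * (c $ i)\<^sup>2)"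
  proof (rule sum_mono)
    fix i assume "i \<in> {..<m}"
    then show "u k * (c $ i)\<^sup>2 \<le> u i * (c $ i)\<^sup>2"
      using c0[of i] u[of k i] by (cases "i < k") (auto intro: mult_right_mono)
  qed
  also have "\<dots> = (\<Sum>i<n. l i * ((R *\<^sub>v c) $ i)\<^sup>2)" by (rule form[OF c(1), symmetric])
  also have "\<dots> \<le> (\<Sum>i<n. l ?K * ((R *\<^sub>v c) $ i)\<^sup>2)"
  proof (rule sum_mono)
    fix i assume "i \<in> {..<n}"
    then show "l i * ((R *\<^sub>v c) $ i)\<^sup>2 \<le> l ?K * ((R *\<^sub>v c) $ i)\<^sup>2"
      using d0[of i] l[of i ?K] k mn by (cases "i > ?K") (auto intro: mult_right_mono)
  qed
  also have "\<dots> = l ?K * (\<Sum>i<m. (c $ i)\<^sup>2)"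
    by (simp add: norm[OF c(1)] flip: sum_distrib_left)
  finally show "u k \<le> l ?K" using pos[OF c] by simp
qed

section \<open>Reduction of principal submatrices to the diagonal case\<close>

text \<open>The index map \<open>f\<close> is injective but need not be increasing, so the rows of
  \<open>B\<close> may be listed in any order.\<close>

theorem cauchy_interlacing:
  fixes A B :: "real mat"
  assumes A: "A \<in> carrier_mat n n" and symA: "transpose_mat A = A"
    and B: "B \<in> carrier_mat m m"
    and inj: "inj_on f {..<m}" and f: "\<And>i. i < m \<Longrightarrow> f i < n"
    and sub: "\<And>i j. i < m \<Longrightarrow> j < m \<Longrightarrow> B $$ (i, j) = A $$ (f i, f j)"
  shows "eigenvalues_interlace B A"
proof -
  have symB: "transpose_mat B = B"
  proof (rule eq_matI)
    fix i j assume "i < dim_row B" "j < dim_col B"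
    then have ij: "i < m" "j < m" using B by auto
    then have "A $$ (f j, f i) = A $$ (f i, f j)"
      using f A by (metis carrier_matD index_transpose_mat(1) symA)
    then show "transpose_mat B $$ (i, j) = B $$ (i, j)" using ij B by (simp add: sub)
  qed (use B in auto)
  have mn: "m \<le> n"
    using card_inj_on_le[OF inj, of "{..<n}"] f by auto
  note eA = eigenvalue_list_symmetric[OF A symA] and eB = eigenvalue_list_symmetric[OF B symB]
  obtain P where P: "P \<in> carrier_mat n n" "transpose_mat P * P = 1\<^sub>m n"
    "transpose_mat P * A * P = mat_diag n ((!) (eigenvalue_list A))"
    using spectral_theorem[OF A symA eA(1)] .
  obtain Q where Q: "Q \<in> carrier_mat m m" "transpose_mat Q * Q = 1\<^sub>m m"
    "transpose_mat Q * B * Q = mat_diag m ((!) (eigenvalue_list B))"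
    using spectral_theorem[OF B symB eB(1)] .
  \<comment> \<open>Column \<open>j\<close> of \<open>E\<close> is the unit vector at
    \<open>f j\<close>: multiplying by \<open>transpose_mat E\<close> on the left selects rows,
    multiplying by \<open>E\<close> on the right selects columns. Injectivity of \<open>f\<close>
    makes these columns orthonormal.\<close>
  define E where "E = mat n m (\<lambda>(i, j). if i = f j then 1 else 0 :: real)"
  have E: "E \<in> carrier_mat n m" by (simp add: E_def)
  have ET: "transpose_mat E * M = mat m k (\<lambda>(i, j). M $$ (f i, j))"
    if "M \<in> carrier_mat n k" for M k
  proof (rule eq_matI)
    fix i j assume "i < dim_row (mat m k (\<lambda>(i, j). M $$ (f i, j)))"
      "j < dim_col (mat m k (\<lambda>(i, j). M $$ (f i, j)))"
    then have ij: "i < m" "j < k" by auto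
    have "(transpose_mat E * M) $$ (i, j) = (\<Sum>p<n. if p = f i then M $$ (p, j) else 0)"
      using ij that f
      by (simp add: E_def scalar_prod_def atLeast0LessThan if_distrib[of "\<lambda>x. x * _"] cong: if_cong)
    then show "(transpose_mat E * M) $$ (i, j) = mat m k (\<lambda>(i, j). M $$ (f i, j)) $$ (i, j)"
      using ij f by simp
  qed (use that E in auto)
  have EE: "transpose_mat E * E = 1\<^sub>m m"
    unfolding ET[OF E] using inj f by (intro eq_matI) (auto simp: E_def inj_on_def)
  have AE: "A * E = mat n m (\<lambda>(i, j). A $$ (i, f j))"
  proof (rule eq_matI)
    fix i j assume "i < dim_row (mat n m (\<lambda>(i, j). A $$ (i, f j)))"
      "j < dim_col (mat n m (\<lambda>(i, j). A $$ (i, f j)))"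
    then have ij: "i < n" "j < m" by auto
    have "(A * E) $$ (i, j) = (\<Sum>p<n. if p = f j then A $$ (i, p) else 0)"
      using ij A f
      by (simp add: E_def scalar_prod_def atLeast0LessThan if_distrib[of "\<lambda>x. _ * x"] cong: if_cong)
    then show "(A * E) $$ (i, j) = mat n m (\<lambda>(i, j). A $$ (i, f j)) $$ (i, j)"
      using ij f by simp
  qed (use A E in auto)
  have EAE: "transpose_mat E * (A * E) = B"
    unfolding AE by (subst ET[of _ m]) (use B f sub in \<open>auto intro!: eq_matI\<close>)
  have PP: "P * transpose_mat P = 1\<^sub>m n"
    using mat_mult_left_right_inverse[of "transpose_mat P" n P] P by auto
  \<comment> \<open>\<open>R\<close> is \<open>E\<close> written in the two eigenbases:
    \<open>Q\<close> leaves the eigencoordinates of \<open>B\<close>, \<open>E\<close> embeds, and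
    \<open>transpose_mat P\<close> enters the eigencoordinates of \<open>A\<close>.\<close>
  define R where "R = transpose_mat P * (E * Q)"
  have R: "R \<in> carrier_mat n m" using P E Q by (simp add: R_def)
  have RT: "transpose_mat R = transpose_mat Q * (transpose_mat E * P)"
    using P(1) E Q(1) unfolding R_def
    by (simp add: transpose_mult[of _ n n _ m] transpose_mult[of _ n m _ m]
        assoc_mult_mat[of _ m m _ n _ n])
  \<comment> \<open>These cancellation rules are shaped for products bracketed to the right, the
    form into which the products with \<open>R\<close> are brought below.\<close>
  have PM: "P * (transpose_mat P * M) = M" if "M \<in> carrier_mat n k" for M k
    using that P(1) PP by (simp flip: assoc_mult_mat[of _ n n _ n _ k])
  have EM: "transpose_mat E * (E * M) = M" if "M \<in> carrier_mat m k" for M k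
    using that E EE by (simp flip: assoc_mult_mat[of _ m n _ m _ k])
  have "transpose_mat R * R = transpose_mat Q * (transpose_mat E * (P * (transpose_mat P * (E * Q))))"
    unfolding RT unfolding R_def using P(1) E Q(1)
    by (simp add: assoc_mult_mat[of _ m m _ n _ m] assoc_mult_mat[of _ m n _ n _ m])
  then have RR: "transpose_mat R * R = 1\<^sub>m m"
    using Q E by (simp add: PM[of _ m] EM[of _ m])
  have "transpose_mat R * (transpose_mat P * A * P) * R =
      transpose_mat Q * (transpose_mat E * (P * (transpose_mat P * (A * (P * (transpose_mat P * (E * Q)))))))"
    unfolding RT unfolding R_def using P(1) E Q(1) A
    by (simp add: assoc_mult_mat[of _ m m _ n _ m] assoc_mult_mat[of _ m n _ n _ m]
       assoc_mult_mat[of _ m m _ n _ n] assoc_mult_mat[of _ m n _ n _ n]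
       assoc_mult_mat[of _ n n _ n _ m] assoc_mult_mat[of _ n n _ n _ n])
  also have "\<dots> = transpose_mat Q * (transpose_mat E * (A * E) * Q)"
    using Q(1) E A by (simp add: PM[of _ m] assoc_mult_mat[of _ m n _ m _ m] assoc_mult_mat[of _ n n _ m _ m])
  also have "\<dots> = transpose_mat Q * B * Q" unfolding EAE using Q(1) B by simp
  finally have diag: "transpose_mat R * mat_diag n ((!) (eigenvalue_list A)) * R =
      mat_diag m ((!) (eigenvalue_list B))" unfolding P(3) Q(3) .
  show ?thesis
    unfolding eigenvalues_interlace_def Let_def
    using diagonal_interlacing[OF R RR diag _ _ mn] A B mn eA(2,3) eB(2,3)
    by (auto simp: sorted_iff_nth_mono)
qed

section \<open>Dirac matrices\<close>

lemma dirac_mat_index: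
  assumes "i < length xs" "j < length xs"
  shows "dirac_mat vs xs $$ (i, j) =
    exterior_derivative vs (xs ! i) (xs ! j) + exterior_derivative vs (xs ! j) (xs ! i)"
  using assms by (simp add: dirac_mat_def exterior_derivative_mat_def)

lemma dirac_mat_carrier: "dirac_mat vs xs \<in> carrier_mat (length xs) (length xs)"
  by (simp add: dirac_mat_def exterior_derivative_mat_def)

lemma dirac_mat_symmetric: "transpose_mat (dirac_mat vs xs) = dirac_mat vs xs"
  using dirac_mat_carrier[of vs xs] by (intro eq_matI) (auto simp: dirac_mat_index)

lemma dirac_mat_interlace:
  assumes "distinct gs" "distinct xs" "set xs \<subseteq> set gs"
  shows "eigenvalues_interlace (dirac_mat vs xs) (dirac_mat vs gs)"
proof -
  \<comment> \<open>\<open>f\<close> sends a position in \<open>xs\<close> to a position of the same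
    simplex in \<open>gs\<close>; it is injective because \<open>xs\<close> has no
    repetitions.\<close>
  define f where "f i = (SOME j. j < length gs \<and> gs ! j = xs ! i)" for i
  have f: "f i < length gs" "gs ! f i = xs ! i" if "i < length xs" for i
  proof -
    have "\<exists>j. j < length gs \<and> gs ! j = xs ! i"
      using assms(3) that by (metis in_set_conv_nth nth_mem subsetD)
    from someI_ex[OF this] show "f i < length gs" "gs ! f i = xs ! i"
      unfolding f_def by auto
  qed
  have "inj_on f {..<length xs}"
    by (rule inj_onI) (metis assms(2) f(2) lessThan_iff nth_eq_iff_index_eq)
  then show ?thesis
    by (rule cauchy_interlacing[OF dirac_mat_carrier dirac_mat_symmetric dirac_mat_carrier])
      (auto simp: f dirac_mat_index)
qed

theorem theorem2:
  fixes G :: "'a set set" and vs :: "'a set \<Rightarrow> 'a list" and gs :: "'a set list"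
  assumes "simplicial_complex G"
    and "vertex_ordering G vs"
    and "distinct gs" and "set gs = G"
  shows "(\<forall>K ks. subcomplex K G \<and> distinct ks \<and> set ks = K \<longrightarrow>
            eigenvalues_interlace (dirac_mat vs ks) (dirac_mat vs gs)) \<and>
         (\<forall>U us. open_subset U G \<and> distinct us \<and> set us = U \<longrightarrow>
            eigenvalues_interlace (dirac_mat vs us) (dirac_mat vs gs))"
  using assms(3,4) by (auto simp: subcomplex_def open_subset_def intro!: dirac_mat_interlace)

end
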